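(* For a set of weights $\mathcal{W}$, $k(\mathcal{W})=\infty$ if and only if one of the following holds: $\mathcal{W}=\mathcal{W}^+$; or $\mathcal{W}=\mathcal{W}^-$; or $\mathcal{W}=\{-\infty,b\}$ for some positive integer $b$; or $\mathcal{W}=\mathcal{W}^-\cup\{N\}$ and $-\infty\notin\mathcal{W}$.
   Context: A coloring game $G=(V,w)$ has a finite set $V$ of $n$ players and symmetric weights $w_{uv}=w_{vu}\in\mathcal{W}$, where $\mathcal{W}\subseteq\mathbb{Z}\cup\{-\infty,N\}$; $-\infty$ means enemies, and $N$ ("best friends") denotes a weight with $N\ge n\cdot|w_{uv}|$ for all weights $w_{uv}\notin\{-\infty,N\}$. $\mathcal{W}^+$ is the subset of non-negative weights of $\mathcal{W}$ and $\mathcal{W}^-$ the subset of non-positive weights (including $-\infty$). For a partition $P$ of $V$ with $X(u)$ the group of $u$, $f_u(P)=\sum_{v\in X(u)\setminus\{u\}} w_{uv}$. A $k$-deviation from $P$ is a set $S$ of at most $k$ players and a (possibly empty) group $X$ of $P$ such that moving all players of $S$ into $X$ strictly increases the utility of every member of $S$; $P$ is $k$-stable if no $k$-deviation exists. $k(\mathcal{W})$ is the largest $k$ (possibly $\infty$) such that every coloring game with weights in $\mathcal{W}$ admits a $k$-stable partition. *)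

theory Defs
  imports Complex_Main "HOL-Library.Disjoint_Sets" "HOL-Library.Extended_Nat"
    "HOL-Library.Extended_Real"
begin

text \<open>
  A weight is an integer, the enemy weight (minus infinity), or the best-friends weight
  \<open>N\<close>.  The latter is a symbol, because its numerical value depends on the game: a bound
  \<open>N \<ge> n \<cdot> \<bar>w\<bar>\<close> involves the number of players and the integer weights occurring there.
\<close>

datatype weight = Fin int | Enemy | Best

fun nonneg_weight :: "weight \<Rightarrow> bool" where
  "nonneg_weight (Fin i) \<longleftrightarrow> 0 \<le> i"
| "nonneg_weight Enemy \<longleftrightarrow> False"
| "nonneg_weight Best \<longleftrightarrow> True"

fun nonpos_weight :: "weight \<Rightarrow> bool" where
  "nonpos_weight (Fin i) \<longleftrightarrow> i \<le> 0"
| "nonpos_weight Enemy \<longleftrightarrow> True"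
| "nonpos_weight Best \<longleftrightarrow> False"

text \<open>Every game interprets \<open>Best\<close> as a positive integer.\<close>

fun pos_int_weight :: "weight \<Rightarrow> bool" where
  "pos_int_weight (Fin i) \<longleftrightarrow> 0 < i"
| "pos_int_weight Enemy \<longleftrightarrow> False"
| "pos_int_weight Best \<longleftrightarrow> True"

definition nonneg_part :: "weight set \<Rightarrow> weight set" where
  "nonneg_part W = {x \<in> W. nonneg_weight x}"

definition nonpos_part :: "weight set \<Rightarrow> weight set" where
  "nonpos_part W = {x \<in> W. nonpos_weight x}"

text \<open>
  The game with players \<open>V\<close> and weights \<open>w\<close>, where \<open>N\<close> is the value of \<open>Best\<close>.
  The diagonal entries \<open>w u u\<close> play no role and are unconstrained.
\<close>

definition coloring_game ::
  "weight set \<Rightarrow> 'a set \<Rightarrow> ('a \<Rightarrow> 'a \<Rightarrow> weight) \<Rightarrow> int \<Rightarrow> bool" where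
  "coloring_game W V w N \<longleftrightarrow>
     finite V \<and>
     (\<forall>u\<in>V. \<forall>v\<in>V. u \<noteq> v \<longrightarrow> w u v \<in> W \<and> w u v = w v u) \<and>
     0 < N \<and>
     (\<forall>u\<in>V. \<forall>v\<in>V. \<forall>i. u \<noteq> v \<longrightarrow> w u v = Fin i \<longrightarrow> int (card V) * \<bar>i\<bar> \<le> N)"

text \<open>The value \<open>\<infinity>\<close> never occurs, so sums of these values are unambiguous.\<close>

fun weight_value :: "int \<Rightarrow> weight \<Rightarrow> ereal" where
  "weight_value N (Fin i) = ereal (real_of_int i)"
| "weight_value N Enemy = - \<infinity>"
| "weight_value N Best = ereal (real_of_int N)"

definition group_of :: "'a set set \<Rightarrow> 'a \<Rightarrow> 'a set" where
  "group_of P u = (THE X. X \<in> P \<and> u \<in> X)"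

definition utility :: "('a \<Rightarrow> 'a \<Rightarrow> weight) \<Rightarrow> int \<Rightarrow> 'a set set \<Rightarrow> 'a \<Rightarrow> ereal" where
  "utility w N P u = (\<Sum>v \<in> group_of P u - {u}. weight_value N (w u v))"

text \<open>
  The partition obtained from \<open>P\<close> by moving \<open>S\<close> into the group \<open>X\<close>; the empty set is
  removed because \<open>partition_on\<close> demands nonempty blocks.
\<close>

definition move :: "'a set set \<Rightarrow> 'a set \<Rightarrow> 'a set \<Rightarrow> 'a set set" where
  "move P S X = insert (X \<union> S) ((\<lambda>Y. Y - S) ` (P - {X})) - {{}}"

text \<open>\<open>S\<close> has to be nonempty, as otherwise the empty set would always be a deviation.\<close>

definition k_deviation ::
  "nat \<Rightarrow> 'a set \<Rightarrow> ('a \<Rightarrow> 'a \<Rightarrow> weight) \<Rightarrow> int \<Rightarrow> 'a set set \<Rightarrow> 'a set \<Rightarrow> 'a set \<Rightarrow> bool" where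
  "k_deviation k V w N P S X \<longleftrightarrow>
     S \<subseteq> V \<and> S \<noteq> {} \<and> card S \<le> k \<and> X \<in> insert {} P \<and>
     (\<forall>u\<in>S. utility w N P u < utility w N (move P S X) u)"

definition k_stable ::
  "nat \<Rightarrow> 'a set \<Rightarrow> ('a \<Rightarrow> 'a \<Rightarrow> weight) \<Rightarrow> int \<Rightarrow> 'a set set \<Rightarrow> bool" where
  "k_stable k V w N P \<longleftrightarrow> (\<nexists>S X. k_deviation k V w N P S X)"

text \<open>
  Games on finite sets of natural numbers represent all finite games up to renaming of players.
  The set below contains \<open>0\<close> and is downward closed, so the supremum is its largest
  element if it is bounded, and \<open>\<infinity>\<close> otherwise.
\<close>

definition stability_number :: "weight set \<Rightarrow> enat" where
  "stability_number W =
     Sup {enat k | k. \<forall>(V :: nat set) w N. coloring_game W V w N \<longrightarrow>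
                        (\<exists>P. partition_on V P \<and> k_stable k V w N P)}"

end

theory Submission imports Defs begin

text \<open>
  If all weights are non-negative, one group is stable; if all are non-positive, singletons are;
  for \<open>{Enemy, b}\<close> the greedy partition into largest cliques is stable; and for non-positive
  weights with \<open>Best\<close> the connected components of the best-friend graph are.

  Otherwise there are weights \<open>c < d\<close> and \<open>e < 0 < d\<close> with either \<open>c = e\<close>, or \<open>e = Enemy\<close> and
  \<open>- d < c\<close>.  Take three mutually hostile (\<open>e\<close>) anchors, which are classes of twins so large that
  everybody else only chooses one of the anchors he likes.  The smaller class \<open>Rover i\<close> likes
  the anchors \<open>i\<close> and \<open>i - 1\<close>, and a single guide in each anchor's group makes it prefer
  \<open>i\<close> slightly.  Company matters more: rover \<open>i\<close> ranks anchor \<open>i\<close> with rover \<open>i + 1\<close>, then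
  anchor \<open>i - 1\<close> with rover \<open>i - 1\<close>, then anchor \<open>i\<close> alone, then anchor \<open>i - 1\<close> alone.
  These cyclic preferences admit no stable assignment.
\<close>

section \<open>Deviations in terms of groups\<close>

definition value_in :: "('a \<Rightarrow> 'a \<Rightarrow> weight) \<Rightarrow> int \<Rightarrow> 'a \<Rightarrow> 'a set \<Rightarrow> ereal" where
  "value_in w N u G = (\<Sum>v\<in>G - {u}. weight_value N (w u v))"

lemma utility_eq_value_in: "utility w N P u = value_in w N u (group_of P u)"
  by (simp add: utility_def value_in_def)

lemma group_of_eqI:
  assumes "partition_on V P" "X \<in> P" "u \<in> X"
  shows "group_of P u = X"
  unfolding group_of_def
proof (rule the_equality)
  show "Y = X" if "Y \<in> P \<and> u \<in> Y" for Y
    using assms that partition_onD2[OF assms(1)] by (auto simp: disjoint_def)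
qed (use assms in auto)

lemma group_of_in:
  assumes "partition_on V P" "u \<in> V"
  shows "group_of P u \<in> P" "u \<in> group_of P u"
proof -
  obtain X where "X \<in> P" "u \<in> X"
    using assms by (auto simp: partition_on_def)
  then show "group_of P u \<in> P" "u \<in> group_of P u"
    using group_of_eqI[OF assms(1)] by auto
qed

lemma group_of_move:
  assumes "u \<in> S"
  shows "group_of (move P S X) u = X \<union> S"
  unfolding group_of_def move_def by (rule the_equality) (use assms in auto)

text \<open>After the move every member of \<open>S\<close> sits in \<open>X \<union> S\<close>,
  whatever becomes of the other groups, so a deviation can be judged without mentioning
  \<open>move\<close>.\<close>

lemma k_stable_iff:
  "k_stable k V w N P \<longleftrightarrow>
    (\<forall>S X. S \<subseteq> V \<longrightarrow> S \<noteq> {} \<longrightarrow> card S \<le> k \<longrightarrow> X \<in> insert {} P \<longrightarrow>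
      (\<exists>u\<in>S. value_in w N u (X \<union> S) \<le> value_in w N u (group_of P u)))"
  unfolding k_stable_def k_deviation_def utility_eq_value_in
  by (simp add: group_of_move not_less del: insert_iff cong: conj_cong)
    (auto simp: group_of_move not_less not_le)

lemma partition_on_subsetD: "partition_on V P \<Longrightarrow> X \<in> insert {} P \<Longrightarrow> X \<subseteq> V"
  by (auto simp: partition_on_def)

section \<open>Reduction of an infinite stability number to stability for every
  \<open>k\<close>\<close>

definition always_stable :: "nat \<Rightarrow> weight set \<Rightarrow> bool" where
  "always_stable k W \<longleftrightarrow> (\<forall>(V :: nat set) w N. coloring_game W V w N \<longrightarrow>
     (\<exists>P. partition_on V P \<and> k_stable k V w N P))"

lemma always_stable_antimono:
  assumes "always_stable k W" "j \<le> k"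
  shows "always_stable j W"
  using assms unfolding always_stable_def k_stable_def k_deviation_def
  by (meson order_trans)

text \<open>The set under the supremum is downward closed, so a single \<open>k\<close> that fails
  bounds it.\<close>

lemma stability_number_eq_infinity_iff:
  "stability_number W = \<infinity> \<longleftrightarrow> (\<forall>k. always_stable k W)"
proof
  assume inf: "stability_number W = \<infinity>"
  show "\<forall>k. always_stable k W"
  proof (rule ccontr)
    assume "\<not> (\<forall>k. always_stable k W)"
    then obtain k where k: "\<not> always_stable k W" by blast
    have "stability_number W \<le> enat k"
      unfolding stability_number_def
    proof (rule Sup_least, clarify)
      fix j
      assume "\<forall>(V :: nat set) w N. coloring_game W V w N \<longrightarrow>
                (\<exists>P. partition_on V P \<and> k_stable j V w N P)"
      then have "always_stable j W" by (simp add: always_stable_def)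
      with k have "\<not> k \<le> j" using always_stable_antimono by blast
      then show "enat j \<le> enat k" by simp
    qed
    with inf show False by simp
  qed
next
  assume all: "\<forall>k. always_stable k W"
  have le: "enat k \<le> stability_number W" for k
    unfolding stability_number_def
    by (rule Sup_upper) (use all in \<open>auto simp: always_stable_def\<close>)
  show "stability_number W = \<infinity>"
  proof (cases "stability_number W")
    case (enat n)
    then show ?thesis using le[of "Suc n"] by simp
  qed
qed

section \<open>Weight sets for which stable partitions always exist\<close>

lemma always_stable_nonneg:
  assumes "\<And>x. x \<in> W \<Longrightarrow> nonneg_weight x"
  shows "always_stable k W"
  unfolding always_stable_def
proof (intro allI impI)
  fix V :: "nat set" and w N
  assume game: "coloring_game W V w N"
  then have fin: "finite V" by (simp add: coloring_game_def)
  have nonneg: "0 \<le> weight_value N (w u v)" if "u \<in> V" "v \<in> V" "u \<noteq> v" for u v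
  proof -
    have "nonneg_weight (w u v)" "0 < N"
      using assms game that by (auto simp: coloring_game_def)
    then show ?thesis by (cases "w u v") auto
  qed
  \<comment> \<open>For empty \<open>V\<close> the difference leaves the empty partition, since
    blocks must be nonempty.\<close>
  let ?P = "{V} - {{}}"
  have part: "partition_on V ?P"
    by (auto simp: partition_on_def disjoint_def)
  have "k_stable k V w N ?P"
    unfolding k_stable_iff
  proof (intro allI impI)
    fix S X
    assume S: "S \<subseteq> V" "S \<noteq> {}" and X: "X \<in> insert {} ?P"
    then obtain u where u: "u \<in> S" by blast
    have "group_of ?P u = V"
      by (rule group_of_eqI[OF part]) (use S u in auto)
    moreover have "value_in w N u (X \<union> S) \<le> value_in w N u V"
      unfolding value_in_def
      by (rule sum_mono2) (use fin S X u nonneg in auto)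
    ultimately show "\<exists>u\<in>S. value_in w N u (X \<union> S) \<le> value_in w N u (group_of ?P u)"
      using u by metis
  qed
  with part show "\<exists>P. partition_on V P \<and> k_stable k V w N P" by blast
qed

lemma always_stable_nonpos:
  assumes "\<And>x. x \<in> W \<Longrightarrow> nonpos_weight x"
  shows "always_stable k W"
  unfolding always_stable_def
proof (intro allI impI)
  fix V :: "nat set" and w N
  assume game: "coloring_game W V w N"
  have nonpos: "weight_value N (w u v) \<le> 0" if "u \<in> V" "v \<in> V" "u \<noteq> v" for u v
  proof -
    have "nonpos_weight (w u v)"
      using assms game that by (auto simp: coloring_game_def)
    then show ?thesis by (cases "w u v") auto
  qed
  let ?P = "(\<lambda>u. {u}) ` V"
  have part: "partition_on V ?P"
    by (auto simp: partition_on_def disjoint_def)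
  have "k_stable k V w N ?P"
    unfolding k_stable_iff
  proof (intro allI impI)
    fix S X
    assume S: "S \<subseteq> V" "S \<noteq> {}" and X: "X \<in> insert {} ?P"
    then obtain u where u: "u \<in> S" by blast
    have "group_of ?P u = {u}"
      by (rule group_of_eqI[OF part]) (use S u in auto)
    moreover have "value_in w N u (X \<union> S) \<le> value_in w N u {u}"
      unfolding value_in_def
      by (simp, rule sum_nonpos) (use S X u nonpos in auto)
    ultimately show "\<exists>u\<in>S. value_in w N u (X \<union> S) \<le> value_in w N u (group_of ?P u)"
      using u by metis
  qed
  with part show "\<exists>P. partition_on V P \<and> k_stable k V w N P" by blast
qed

text \<open>The partition is obtained greedily, by repeatedly removing a largest clique.\<close>

lemma greedy_clique_partition:
  fixes clique :: "'a set \<Rightarrow> bool"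
  assumes "finite V"
    and single: "\<And>v. clique {v}"
    and subset: "\<And>A B. clique B \<Longrightarrow> A \<subseteq> B \<Longrightarrow> clique A"
  shows "\<exists>P. partition_on V P \<and> (\<forall>C\<in>P. clique C) \<and>
    (\<forall>K. K \<subseteq> V \<longrightarrow> K \<noteq> {} \<longrightarrow> clique K \<longrightarrow> (\<exists>C\<in>P. K \<inter> C \<noteq> {} \<and> card K \<le> card C))"
  using assms(1)
proof (induction V rule: finite_psubset_induct)
  case (psubset V)
  show ?case
  proof (cases "V = {}")
    case True
    then show ?thesis by (intro exI[of _ "{}"]) (auto simp: partition_on_def)
  next
    case False
    then obtain v where v: "v \<in> V" by blast
    let ?Q = "\<lambda>C. C \<subseteq> V \<and> C \<noteq> {} \<and> clique C"
    have "?Q {v}" using v single by auto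
    moreover have "\<forall>C. ?Q C \<longrightarrow> card C < Suc (card V)"
      using psubset.hyps card_mono by (auto simp: less_Suc_eq_le)
    ultimately obtain C where C: "?Q C" and max: "\<forall>D. ?Q D \<longrightarrow> card D \<le> card C"
      using ex_has_greatest_nat[of ?Q "{v}" card "Suc (card V)"] by blast
    have "V - C \<subset> V" using C by blast
    from psubset.IH[OF this] obtain P where P: "partition_on (V - C) P" "\<forall>C\<in>P. clique C"
      "\<And>K. K \<subseteq> V - C \<Longrightarrow> K \<noteq> {} \<Longrightarrow> clique K \<Longrightarrow> \<exists>C\<in>P. K \<inter> C \<noteq> {} \<and> card K \<le> card C"
      by blast
    have "partition_on V (insert C P)"
      using P(1) C unfolding partition_on_def disjoint_def by auto
    \<comment> \<open>A clique meeting \<open>C\<close> is no larger than \<open>C\<close>; one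
      missing \<open>C\<close> lies in \<open>V - C\<close>, where the induction hypothesis
      applies.\<close>
    moreover have "\<exists>D\<in>insert C P. K \<inter> D \<noteq> {} \<and> card K \<le> card D"
      if "K \<subseteq> V" "K \<noteq> {}" "clique K" for K
    proof (cases "K \<inter> C = {}")
      case True
      then show ?thesis using P(3)[of K] that by blast
    next
      case False
      then show ?thesis using max that by blast
    qed
    ultimately show ?thesis
      using P(2) C by (intro exI[of _ "insert C P"]) auto
  qed
qed

text \<open>If the new group \<open>X \<union> S\<close> is no clique, some deviator meets an enemy
  there. If it is one, it shares a player with a block \<open>C\<close> at least as large. When that
  player is in \<open>S\<close>, it gains nothing; when it is in \<open>X\<close>, then
  \<open>C = X\<close>, and comparing sizes shows that nobody has moved.\<close>

lemma always_stable_Enemy_positive: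
  assumes b: "pos_int_weight b"
  shows "always_stable k {Enemy, b}"
  unfolding always_stable_def
proof (intro allI impI)
  fix V :: "nat set" and w N
  assume game: "coloring_game {Enemy, b} V w N"
  then have fin: "finite V" and N: "0 < N" by (auto simp: coloring_game_def)
  obtain r where r: "weight_value N b = ereal r" "0 < r"
    using b N by (cases b) auto
  let ?clique = "\<lambda>C. \<forall>u\<in>C. \<forall>v\<in>C. u \<noteq> v \<longrightarrow> w u v = b"
  obtain P where P: "partition_on V P" "\<forall>C\<in>P. ?clique C"
    and big: "\<And>K. K \<subseteq> V \<Longrightarrow> K \<noteq> {} \<Longrightarrow> ?clique K \<Longrightarrow> \<exists>C\<in>P. K \<inter> C \<noteq> {} \<and> card K \<le> card C"
  proof -
    have "\<exists>P. partition_on V P \<and> (\<forall>C\<in>P. ?clique C) \<and>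
        (\<forall>K. K \<subseteq> V \<longrightarrow> K \<noteq> {} \<longrightarrow> ?clique K \<longrightarrow> (\<exists>C\<in>P. K \<inter> C \<noteq> {} \<and> card K \<le> card C))"
      by (rule greedy_clique_partition[OF fin]) blast+
    then show ?thesis using that by blast
  qed
  \<comment> \<open>Inside cliques only the size counts. The truncated subtraction is harmless
    because \<open>u \<in> K\<close>.\<close>
  have val: "value_in w N u K = ereal (real (card K - 1) * r)"
    if "K \<subseteq> V" "?clique K" "u \<in> K" for K u
  proof -
    have "finite K" using that fin finite_subset by blast
    have "value_in w N u K = (\<Sum>v\<in>K - {u}. ereal r)"
      unfolding value_in_def using that r by (intro sum.cong) auto
    also have "\<dots> = ereal (\<Sum>v\<in>K - {u}. r)" by (rule sum_ereal)
    also have "\<dots> = ereal (real (card K - 1) * r)"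
      using that \<open>finite K\<close> by (simp add: card_Diff_singleton)
    finally show ?thesis .
  qed
  have "k_stable k V w N P"
    unfolding k_stable_iff
  proof (intro allI impI)
    fix S X
    assume S: "S \<subseteq> V" "S \<noteq> {}" and X: "X \<in> insert {} P"
    let ?K = "X \<union> S"
    have XV: "X \<subseteq> V" using X P(1) partition_on_subsetD by blast
    show "\<exists>u\<in>S. value_in w N u ?K \<le> value_in w N u (group_of P u)"
    proof (cases "?clique ?K")
      case True
      then obtain C u where C: "C \<in> P" "u \<in> ?K" "u \<in> C" "card ?K \<le> card C"
        using big[of ?K] S XV by auto
      have CV: "C \<subseteq> V" using C P(1) partition_on_subsetD by blast
      show ?thesis
      proof (cases "u \<in> S")
        case True
        have "value_in w N u ?K \<le> value_in w N u C"
          using val[of ?K u] val[of C u] \<open>?clique ?K\<close> C P(2) S XV CV r(2)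
          by (simp add: mult_right_mono)
        then show ?thesis using True group_of_eqI[OF P(1)] C by auto
      next
        case False
        then have "u \<in> X" "X \<in> P" using C X by auto
        then have "C = X" using group_of_eqI[OF P(1)] C by auto
        have "finite ?K" using S XV fin finite_subset by blast
        then have KX: "?K = X" using C(4) \<open>C = X\<close> by (metis Un_upper1 card_seteq)
        obtain v where v: "v \<in> S" using S by blast
        then have "group_of P v = X"
          using group_of_eqI[OF P(1) \<open>X \<in> P\<close>] KX by auto
        then show ?thesis using v KX by auto
      qed
    next
      case False
      then obtain u v where uv: "u \<in> ?K" "v \<in> ?K" "u \<noteq> v" "w u v \<noteq> b" by blast
      have uvV: "u \<in> V" "v \<in> V" using uv S XV by auto
      from game have "\<forall>u\<in>V. \<forall>v\<in>V. u \<noteq> v \<longrightarrow> w u v \<in> {Enemy, b} \<and> w u v = w v u"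
        unfolding coloring_game_def by (elim conjE)
      from this[rule_format, OF uvV uv(3)]
      have "w u v \<in> {Enemy, b}" and sym: "w u v = w v u" by blast+
      then have en: "w u v = Enemy" using uv(4) by blast
      \<comment> \<open>\<open>X\<close> itself is empty or a clique, so a pair of enemies involves
        a deviator.\<close>
      have "u \<in> S \<or> v \<in> S"
        using uv X P(2) by auto
      then obtain x y where xy: "x \<in> S" "y \<in> ?K" "x \<noteq> y" "w x y = Enemy"
        using uv sym en by metis
      have fK: "finite ?K" using S XV fin finite_subset by blast
      have "value_in w N x ?K = - \<infinity>"
      proof -
        have "value_in w N x ?K = weight_value N (w x y) + (\<Sum>v\<in>?K - {x} - {y}. weight_value N (w x v))"
          unfolding value_in_def using fK xy by (intro sum.remove) auto
        \<comment> \<open>In \<open>ereal\<close> the two infinities add up to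
          \<open>\<infinity>\<close>, so the remaining sum must be shown to differ from
          \<open>\<infinity>\<close>.\<close>
        moreover have "(\<Sum>v\<in>?K - {x} - {y}. weight_value N (w x v)) \<noteq> \<infinity>"
        proof -
          have "weight_value N z \<noteq> \<infinity>" for z by (cases z) auto
          then show ?thesis by (simp add: sum_Pinfty)
        qed
        ultimately show ?thesis using xy by simp
      qed
      then show ?thesis using xy by (intro bexI[of _ x]) auto
    qed
  qed
  with P(1) show "\<exists>P. partition_on V P \<and> k_stable k V w N P" by blast
qed

text \<open>All non-friends together cost a player at most \<open>N\<close>, the worth of one
  friend. So a deviator keeps all its friends, and the new group swallows its whole component; the
  additional members are not its friends and cannot make it gain.\<close>

lemma always_stable_nonpos_Best:
  assumes W: "\<And>x. x \<in> W \<Longrightarrow> x = Best \<or> (\<exists>i\<le>0. x = Fin i)"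
  shows "always_stable k W"
  unfolding always_stable_def
proof (intro allI impI)
  fix V :: "nat set" and w N
  assume game: "coloring_game W V w N"
  then have fin: "finite V" and N: "0 < N" by (auto simp: coloring_game_def)
  define E where "E = {(u, v). u \<in> V \<and> v \<in> V \<and> u \<noteq> v \<and> w u v = Best}"
  define C where "C u = {v \<in> V. (u, v) \<in> E\<^sup>*}" for u
  define F where "F u = {v \<in> V. v \<noteq> u \<and> w u v = Best}" for u
  \<comment> \<open>Without enemies all values are finite, so real arithmetic is available.\<close>
  define \<rho> where "\<rho> u v = real_of_ereal (weight_value N (w u v))" for u v
  have "sym E"
    using game by (auto simp: E_def sym_def coloring_game_def)
  then have symE: "(v, u) \<in> E\<^sup>*" if "(u, v) \<in> E\<^sup>*" for u v
    using that by (meson sym_rtrancl symD)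
  have CV: "C u \<subseteq> V" and refl: "u \<in> V \<Longrightarrow> u \<in> C u" for u
    by (auto simp: C_def)
  have Ceq: "C v = C u" if "v \<in> C u" for u v
    using that symE by (auto simp: C_def intro: rtrancl_trans)
  have FC: "F u \<subseteq> C v" if "u \<in> C v" for u v
    using that by (auto simp: C_def F_def E_def intro: rtrancl_into_rtrancl)
  let ?P = "C ` V"
  have part: "partition_on V ?P"
  proof (rule partition_onI)
    show "\<Union>?P = V" using refl CV by blast
    show "{} \<notin> ?P" using refl by blast
    show "disjnt p q" if pq: "p \<in> ?P" "q \<in> ?P" "p \<noteq> q" for p q
    proof -
      obtain u v where "p = C u" "q = C v" using pq by blast
      then show ?thesis using Ceq[of _ u] Ceq[of _ v] \<open>p \<noteq> q\<close> unfolding disjnt_iff by metis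
    qed
  qed
  have group: "group_of ?P u = C u" if "u \<in> V" for u
    by (rule group_of_eqI[OF part]) (use that refl in auto)
  have \<rho>: "weight_value N (w u v) = ereal (\<rho> u v)"
    "v \<in> F u \<Longrightarrow> \<rho> u v = real_of_int N"
    "v \<notin> F u \<Longrightarrow> \<rho> u v \<le> 0"
    "v \<notin> F u \<Longrightarrow> - real_of_int N \<le> real (card V) * \<rho> u v"
    if uv: "u \<in> V" "v \<in> V" "u \<noteq> v" for u v
  proof -
    have "w u v \<in> W" and b: "w u v = Fin i \<Longrightarrow> int (card V) * \<bar>i\<bar> \<le> N" for i
      using game uv by (auto simp: coloring_game_def)
    then consider "w u v = Best" | i where "w u v = Fin i" "i \<le> 0"
      using W by blast
    note cases = this
    show "weight_value N (w u v) = ereal (\<rho> u v)" "v \<in> F u \<Longrightarrow> \<rho> u v = real_of_int N"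
      "v \<notin> F u \<Longrightarrow> \<rho> u v \<le> 0"
      using cases uv by (cases; auto simp: \<rho>_def F_def)+
    show "- real_of_int N \<le> real (card V) * \<rho> u v" if "v \<notin> F u"
      using cases
    proof cases
      case 1
      then show ?thesis using that uv by (simp add: F_def)
    next
      case (2 i)
      then have "int (card V) * (- i) \<le> N" using b[of i] by simp
      then have "real_of_int (int (card V) * (- i)) \<le> real_of_int N"
        by (simp only: of_int_le_iff)
      then show ?thesis using 2 by (simp add: \<rho>_def)
    qed
  qed
  have val: "value_in w N u G = ereal (\<Sum>v\<in>G - {u}. \<rho> u v)" if "u \<in> V" "G \<subseteq> V" for u G
  proof -
    have "value_in w N u G = (\<Sum>v\<in>G - {u}. ereal (\<rho> u v))"
      unfolding value_in_def using that \<rho>(1) by (intro sum.cong) auto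
    then show ?thesis by simp
  qed
  have split: "(\<Sum>v\<in>G - {u}. \<rho> u v) =
      real (card (F u \<inter> G)) * real_of_int N + (\<Sum>v\<in>G - {u} - F u. \<rho> u v)"
    if "u \<in> V" "G \<subseteq> V" for u G
  proof -
    have "finite G" using that fin finite_subset by blast
    then have "(\<Sum>v\<in>G - {u}. \<rho> u v) =
        (\<Sum>v\<in>(G - {u}) \<inter> F u. \<rho> u v) + (\<Sum>v\<in>G - {u} - F u. \<rho> u v)"
      by (intro sum.Int_Diff) auto
    also have "(\<Sum>v\<in>(G - {u}) \<inter> F u. \<rho> u v) = (\<Sum>v\<in>(G - {u}) \<inter> F u. real_of_int N)"
      using that \<rho>(2) by (intro sum.cong) auto
    also have "(G - {u}) \<inter> F u = F u \<inter> G"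
      by (auto simp: F_def)
    finally show ?thesis by simp
  qed
  have "k_stable k V w N ?P"
    unfolding k_stable_iff
  proof (intro allI impI, rule ccontr)
    fix S X
    assume S: "S \<subseteq> V" "S \<noteq> {}" and X: "X \<in> insert {} ?P"
      and dev: "\<not> (\<exists>u\<in>S. value_in w N u (X \<union> S) \<le> value_in w N u (group_of ?P u))"
    have XS: "X \<union> S \<subseteq> V"
      using S X part partition_on_subsetD by blast
    have better: "(\<Sum>v\<in>C u - {u}. \<rho> u v) < (\<Sum>v\<in>(X \<union> S) - {u}. \<rho> u v)"
      if "u \<in> S" for u
    proof -
      have "u \<in> V" "value_in w N u (C u) < value_in w N u (X \<union> S)"
        using that S dev group[of u] by (metis subsetD, metis not_le subsetD)
      then show ?thesis using val[of u] CV[of u] XS by simp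
    qed
    \<comment> \<open>Losing a friend costs at least \<open>N\<close>. The non-friends in
      \<open>C u\<close> are at most \<open>n\<close>, each of weight at least
      \<open>- N / n\<close>, so leaving them recovers at most \<open>N\<close>: there is no strict
      gain.\<close>
    have friends: "F u \<subseteq> X \<union> S" if u: "u \<in> S" for u
    proof (rule ccontr)
      assume "\<not> F u \<subseteq> X \<union> S"
      then have "F u \<inter> (X \<union> S) \<subset> F u" by blast
      moreover have "finite (F u)" using fin by (simp add: F_def)
      ultimately have "card (F u \<inter> (X \<union> S)) < card (F u)" by (rule psubset_card_mono[rotated])
      then have less: "real (card (F u \<inter> (X \<union> S))) * real_of_int N \<le> (real (card (F u)) - 1) * real_of_int N"
        using N by (intro mult_right_mono) auto
      have uV: "u \<in> V" using u S by blast
      have new: "(\<Sum>v\<in>(X \<union> S) - {u} - F u. \<rho> u v) \<le> 0"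
        by (rule sum_nonpos) (use uV XS \<rho>(3) in auto)
      define n where "n = real (card V)"
      have n: "0 < n" using uV fin by (auto simp: n_def card_gt_0_iff)
      have "(\<Sum>v\<in>C u - {u} - F u. - (real_of_int N / n)) \<le> (\<Sum>v\<in>C u - {u} - F u. \<rho> u v)"
        using \<rho>(4)[OF uV] CV n by (intro sum_mono) (auto simp: n_def field_simps)
      moreover have "real (card (C u - {u} - F u)) \<le> n"
        unfolding n_def using CV fin by (intro of_nat_mono card_mono) auto
      then have "real (card (C u - {u} - F u)) * (real_of_int N / n) \<le> n * (real_of_int N / n)"
        using N n by (intro mult_right_mono) auto
      ultimately have "- real_of_int N \<le> (\<Sum>v\<in>C u - {u} - F u. \<rho> u v)"
        using n by simp
      moreover have "F u \<inter> C u = F u"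
        using FC[of u u] refl[OF uV] by blast
      ultimately show False
        using better[OF u] split[OF uV CV[of u]] split[OF uV XS] less new
        by (simp add: algebra_simps)
    qed
    obtain u where u: "u \<in> S" using S by blast
    then have uV: "u \<in> V" using S by blast
    \<comment> \<open>Along a path of friends: from a member of \<open>S\<close> the next player is
      in the new group by \<open>friends\<close>, from a member of \<open>X\<close> because
      \<open>X\<close> is a component.\<close>
    have "v \<in> X \<union> S" if "(u, v) \<in> E\<^sup>*" for v
      using that
    proof (induction rule: rtrancl_induct)
      case base
      then show ?case using u by simp
    next
      case (step v v')
      then have v': "v' \<in> F v" by (auto simp: E_def F_def)
      show ?case
      proof (cases "v \<in> S")
        case True
        then show ?thesis using friends v' by blast
      next
        case False
        then obtain x where "X = C x" "v \<in> C x" using step X by auto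
        then show ?thesis using FC v' by blast
      qed
    qed
    then have sub: "C u \<subseteq> X \<union> S" by (auto simp: C_def)
    have "(\<Sum>v\<in>(X \<union> S) - {u}. \<rho> u v) =
        (\<Sum>v\<in>(X \<union> S) - {u} - (C u - {u}). \<rho> u v) + (\<Sum>v\<in>C u - {u}. \<rho> u v)"
      by (rule sum.subset_diff) (use sub XS fin finite_subset in auto)
    moreover have "(\<Sum>v\<in>(X \<union> S) - {u} - (C u - {u}). \<rho> u v) \<le> 0"
    proof (rule sum_nonpos)
      fix v
      assume "v \<in> (X \<union> S) - {u} - (C u - {u})"
      then show "\<rho> u v \<le> 0"
        using FC[of u u] refl[OF uV] XS uV by (intro \<rho>(3)) auto
    qed
    ultimately show False using better[OF u] by simp
  qed
  with part show "\<exists>P. partition_on V P \<and> k_stable k V w N P" by blast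
qed

section \<open>Blown-up games\<close>

text \<open>
  Replace each point of a small game by a class of twins who like each other.  In a stable
  partition twins are together: otherwise the one with the lower utility would join the other.
  Hence only the deviations of whole classes matter.
\<close>

definition class_value ::
  "'a set \<Rightarrow> ('a \<Rightarrow> 'k) \<Rightarrow> ('k \<Rightarrow> 'k \<Rightarrow> weight) \<Rightarrow> int \<Rightarrow> 'k \<Rightarrow> 'k set \<Rightarrow> ereal" where
  "class_value V t r N \<kappa> G = (\<Sum>v\<in>{v \<in> V. t v \<in> G}. weight_value N (r \<kappa> (t v)))"

lemma stable_blowup:
  fixes t :: "'a \<Rightarrow> 'k" and r :: "'k \<Rightarrow> 'k \<Rightarrow> weight"
  assumes fin: "finite V" and onto: "t ` V = UNIV"
    and self: "\<And>\<kappa>. \<exists>d>0. weight_value N (r \<kappa> \<kappa>) = ereal d"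
    and part: "partition_on V P"
    and stable: "k_stable (card V) V (\<lambda>u v. r (t u) (t v)) N P"
  shows "\<exists>g. (\<forall>\<kappa>. \<kappa> \<in> g \<kappa>) \<and> (\<forall>\<kappa> \<kappa>'. \<kappa>' \<in> g \<kappa> \<longrightarrow> g \<kappa>' = g \<kappa>) \<and>
    (\<forall>S X. S \<noteq> {} \<longrightarrow> X \<in> insert {} (range g) \<longrightarrow>
      (\<exists>\<kappa>\<in>S. class_value V t r N \<kappa> (X \<union> S) \<le> class_value V t r N \<kappa> (g \<kappa>)))"
proof -
  define w where "w = (\<lambda>u v. r (t u) (t v))"
  \<comment> \<open>Unlike \<open>value_in\<close>, this also counts the player itself. By
    \<open>self\<close> that adds the same finite amount on both sides of a comparison, and twins
    get equal values.\<close>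
  define F where "F \<kappa> G = (\<Sum>v\<in>G. weight_value N (r \<kappa> (t v)))" for \<kappa> G
  have F_insert: "F \<kappa> (insert u G) = weight_value N (r \<kappa> (t u)) + F \<kappa> G" if "finite G" "u \<notin> G" for \<kappa> u G
    using that by (simp add: F_def)
  have F_value_in: "F (t u) G = weight_value N (r (t u) (t u)) + value_in w N u G"
    if "u \<in> G" "G \<subseteq> V" for u G
    unfolding F_def value_in_def w_def using that fin finite_subset by (intro sum.remove) auto
  have F_le: "F (t u) G \<le> F (t u) H \<longleftrightarrow> value_in w N u G \<le> value_in w N u H"
    if "u \<in> G" "G \<subseteq> V" "u \<in> H" "H \<subseteq> V" for u G H
    using F_value_in[OF that(1,2)] F_value_in[OF that(3,4)] self[of "t u"]
    by (auto simp: ereal_add_le_add_iff)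
  note group = group_of_in[OF part]
  have groupV: "group_of P u \<subseteq> V" if "u \<in> V" for u
    using group(1)[OF that] part partition_on_subsetD by blast
  have dev: "\<exists>u\<in>S. F (t u) (X \<union> S) \<le> F (t u) (group_of P u)"
    if S: "S \<subseteq> V" "S \<noteq> {}" and X: "X \<in> insert {} P" for S X
  proof -
    \<comment> \<open>With \<open>k = card V\<close> the size of a coalition is no
      restriction.\<close>
    have "card S \<le> card V" using S fin card_mono by blast
    then obtain u where u: "u \<in> S" "value_in w N u (X \<union> S) \<le> value_in w N u (group_of P u)"
      using stable S X unfolding k_stable_iff w_def by blast
    have "X \<subseteq> V" using X part partition_on_subsetD by blast
    then show ?thesis
      using u S F_le[of u "X \<union> S" "group_of P u"] group[of u] groupV[of u] by auto
  qed
  \<comment> \<open>Joining \<open>v\<close> would give \<open>u\<close> an extra \<open>d\<close>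
    on top of a value no smaller than its own. This is a strict gain because the values are finite:
    being alone already yields \<open>d\<close>, and no weight is
    \<open>\<infinity>\<close>.\<close>
  have twins_le: "group_of P u = group_of P v"
    if uv: "u \<in> V" "v \<in> V" "t u = t v" and le: "F (t u) (group_of P u) \<le> F (t u) (group_of P v)" for u v
  proof (rule ccontr)
    assume neq: "group_of P u \<noteq> group_of P v"
    obtain d where d: "d > 0" "weight_value N (r (t u) (t u)) = ereal d"
      using self by blast
    have "u \<notin> group_of P v"
      using neq group_of_eqI[OF part] group[OF uv(2)] by metis
    moreover have "finite (group_of P v)" using groupV[OF uv(2)] fin finite_subset by blast
    moreover have "F (t u) (group_of P v \<union> {u}) \<le> F (t u) (group_of P u)"
      using dev[of "{u}" "group_of P v"] uv group(1)[OF uv(2)] by auto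
    ultimately have join: "ereal d + F (t u) (group_of P v) \<le> F (t u) (group_of P u)"
      using F_insert[of "group_of P v" u "t u"] d by simp
    have alone: "ereal d \<le> F (t u) (group_of P u)"
      using dev[of "{u}" "{}"] uv d by (auto simp: F_def)
    have "weight_value N z \<noteq> \<infinity>" for z by (cases z) auto
    then have "F (t u) (group_of P v) \<noteq> \<infinity>" by (simp add: F_def sum_Pinfty)
    with join alone le d(1) show False
      by (cases "F (t u) (group_of P v)"; cases "F (t u) (group_of P u)") auto
  qed
  have twins: "group_of P u = group_of P v" if "u \<in> V" "v \<in> V" "t u = t v" for u v
    using twins_le[of u v] twins_le[of v u] that linear by metis
  define rep where "rep \<kappa> = (SOME v. v \<in> V \<and> t v = \<kappa>)" for \<kappa>
  have rep: "rep \<kappa> \<in> V" "t (rep \<kappa>) = \<kappa>" for \<kappa>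
  proof -
    have "\<exists>v. v \<in> V \<and> t v = \<kappa>" using onto by (metis UNIV_I imageE)
    then show "rep \<kappa> \<in> V" "t (rep \<kappa>) = \<kappa>" unfolding rep_def by (metis (mono_tags, lifting) someI_ex)+
  qed
  \<comment> \<open>As twins are together, each group is a union of whole classes, and
    \<open>g\<close> records which ones.\<close>
  define g where "g \<kappa> = t ` group_of P (rep \<kappa>)" for \<kappa>
  have preimage: "{v \<in> V. t v \<in> g \<kappa>} = group_of P (rep \<kappa>)" for \<kappa>
  proof
    show "group_of P (rep \<kappa>) \<subseteq> {v \<in> V. t v \<in> g \<kappa>}"
      using groupV[OF rep(1)] by (auto simp: g_def)
    show "{v \<in> V. t v \<in> g \<kappa>} \<subseteq> group_of P (rep \<kappa>)"
    proof clarify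
      fix v
      assume v: "v \<in> V" "t v \<in> g \<kappa>"
      then obtain u where u: "u \<in> group_of P (rep \<kappa>)" "t v = t u" by (auto simp: g_def)
      then have "u \<in> V" using groupV[OF rep(1)] by blast
      then have "group_of P v = group_of P u" using twins v u by blast
      also have "\<dots> = group_of P (rep \<kappa>)"
        using group_of_eqI[OF part group(1)[OF rep(1)] u(1)] .
      finally show "v \<in> group_of P (rep \<kappa>)" using group(2)[OF v(1)] by simp
    qed
  qed
  have F_class: "class_value V t r N \<kappa> G = F \<kappa> {v \<in> V. t v \<in> G}" for \<kappa> G
    by (simp add: class_value_def F_def)
  have g_self: "\<kappa> \<in> g \<kappa>" for \<kappa>
    using group(2)[OF rep(1), of \<kappa>] rep(2)[of \<kappa>] unfolding g_def by (metis imageI)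
  have g_eq: "g \<kappa>' = g \<kappa>" if "\<kappa>' \<in> g \<kappa>" for \<kappa> \<kappa>'
  proof -
    have "rep \<kappa>' \<in> {v \<in> V. t v \<in> g \<kappa>}" using that rep by simp
    then have "rep \<kappa>' \<in> group_of P (rep \<kappa>)" by (simp only: preimage)
    then show ?thesis using group_of_eqI[OF part group(1)[OF rep(1)]] by (metis g_def)
  qed
  have g_dev: "\<exists>\<kappa>\<in>S. class_value V t r N \<kappa> (X \<union> S) \<le> class_value V t r N \<kappa> (g \<kappa>)"
    if S: "S \<noteq> {}" and X: "X \<in> insert {} (range g)" for S X
  proof -
    let ?pre = "\<lambda>G. {v \<in> V. t v \<in> G}"
    have "?pre X \<in> insert {} P"
      using X preimage group(1)[OF rep(1)] by auto
    moreover have "?pre S \<noteq> {}" using S rep by (metis (mono_tags, lifting) all_not_in_conv mem_Collect_eq)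
    ultimately obtain u where u: "u \<in> ?pre S" "F (t u) (?pre X \<union> ?pre S) \<le> F (t u) (group_of P u)"
      using dev[of "?pre S" "?pre X"] by blast
    have "?pre X \<union> ?pre S = ?pre (X \<union> S)" by blast
    moreover have "group_of P u = ?pre (g (t u))"
      using twins[of u "rep (t u)"] u rep preimage[of "t u"] by simp
    ultimately have "class_value V t r N (t u) (X \<union> S) \<le> class_value V t r N (t u) (g (t u))"
      using u(2) by (simp only: F_class)
    then show ?thesis using u(1) by blast
  qed
  show ?thesis
    by (intro exI[of _ g] conjI allI impI g_self g_eq g_dev)
qed

text \<open>Sorting the players by class gives a sum weighted by class sizes. The inequality serves
  groups that may contain enemies, where a real number can only bound the weight from above.\<close>

lemma class_value_le:
  fixes t :: "'a \<Rightarrow> 'k"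
  assumes "finite V" "t ` V = UNIV"
    and "\<And>\<kappa>'. \<kappa>' \<in> G \<Longrightarrow> weight_value N (r \<kappa> \<kappa>') \<le> ereal (\<rho> \<kappa>')"
  shows "class_value V t r N \<kappa> G \<le> ereal (\<Sum>\<kappa>'\<in>G. real (card {v \<in> V. t v = \<kappa>'}) * \<rho> \<kappa>')"
    and "(\<And>\<kappa>'. \<kappa>' \<in> G \<Longrightarrow> weight_value N (r \<kappa> \<kappa>') = ereal (\<rho> \<kappa>')) \<Longrightarrow>
      class_value V t r N \<kappa> G = ereal (\<Sum>\<kappa>'\<in>G. real (card {v \<in> V. t v = \<kappa>'}) * \<rho> \<kappa>')"
proof -
  let ?A = "{v \<in> V. t v \<in> G}"
  have "t ` ?A = G" using assms(2) by (auto simp: image_iff)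
  moreover have "(\<Sum>v\<in>?A. \<rho> (t v)) = (\<Sum>\<kappa>'\<in>t ` ?A. \<Sum>v\<in>{v \<in> ?A. t v = \<kappa>'}. \<rho> (t v))"
    using assms(1) by (intro sum.image_gen) auto
  ultimately have "(\<Sum>v\<in>?A. \<rho> (t v)) = (\<Sum>\<kappa>'\<in>G. \<Sum>v\<in>{v \<in> ?A. t v = \<kappa>'}. \<rho> (t v))" by simp
  also have "\<dots> = (\<Sum>\<kappa>'\<in>G. real (card {v \<in> V. t v = \<kappa>'}) * \<rho> \<kappa>')"
  proof (rule sum.cong)
    fix \<kappa>'
    assume "\<kappa>' \<in> G"
    then have "{v \<in> ?A. t v = \<kappa>'} = {v \<in> V. t v = \<kappa>'}" by auto
    then show "(\<Sum>v\<in>{v \<in> ?A. t v = \<kappa>'}. \<rho> (t v)) = real (card {v \<in> V. t v = \<kappa>'}) * \<rho> \<kappa>'"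
      by simp
  qed simp
  finally have eq: "(\<Sum>v\<in>?A. ereal (\<rho> (t v))) = ereal (\<Sum>\<kappa>'\<in>G. real (card {v \<in> V. t v = \<kappa>'}) * \<rho> \<kappa>')"
    by simp
  show "class_value V t r N \<kappa> G \<le> ereal (\<Sum>\<kappa>'\<in>G. real (card {v \<in> V. t v = \<kappa>'}) * \<rho> \<kappa>')"
    unfolding class_value_def eq[symmetric] by (rule sum_mono) (use assms(3) in auto)
  show "class_value V t r N \<kappa> G = ereal (\<Sum>\<kappa>'\<in>G. real (card {v \<in> V. t v = \<kappa>'}) * \<rho> \<kappa>')"
    if "\<And>\<kappa>'. \<kappa>' \<in> G \<Longrightarrow> weight_value N (r \<kappa> \<kappa>') = ereal (\<rho> \<kappa>')"
    unfolding class_value_def eq[symmetric] by (rule sum.cong) (use that in auto)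
qed

section \<open>A cyclic game with nine classes\<close>

datatype cyc3 = C0 | C1 | C2

fun nxt :: "cyc3 \<Rightarrow> cyc3" where
  "nxt C0 = C1" | "nxt C1 = C2" | "nxt C2 = C0"

lemma nxt_simps [simp]:
  "nxt (nxt (nxt i)) = i" "nxt i \<noteq> i" "i \<noteq> nxt i" "nxt (nxt i) \<noteq> i" "i \<noteq> nxt (nxt i)"
  "nxt i = nxt j \<longleftrightarrow> i = j"
  by (cases i; cases j; simp)+

lemma cyc3_cases: "j = i \<or> j = nxt i \<or> j = nxt (nxt i)"
  by (cases i; cases j; simp)

datatype kind = Rover cyc3 | Anchor cyc3 | Guide cyc3

text \<open>The condition \<open>i = nxt j\<close> says that \<open>j\<close> is the predecessor of
  \<open>i\<close>. The entry type is a variable, so that one table yields symbolic weights, their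
  real values and, with truth values, the hostile pairs.\<close>

fun pattern :: "'b \<Rightarrow> 'b \<Rightarrow> 'b \<Rightarrow> kind \<Rightarrow> kind \<Rightarrow> 'b" where
  "pattern c d e (Rover i) (Rover j) = d"
| "pattern c d e (Rover i) (Anchor j) = (if i = j \<or> i = nxt j then d else e)"
| "pattern c d e (Rover i) (Guide j) = (if i = j then d else if i = nxt j then c else e)"
| "pattern c d e (Anchor j) (Rover i) = (if i = j \<or> i = nxt j then d else e)"
| "pattern c d e (Anchor i) (Anchor j) = (if i = j then d else e)"
| "pattern c d e (Anchor i) (Guide j) = (if i = j then d else e)"
| "pattern c d e (Guide j) (Rover i) = (if i = j then d else if i = nxt j then c else e)"
| "pattern c d e (Guide i) (Anchor j) = (if i = j then d else e)"
| "pattern c d e (Guide i) (Guide j) = (if i = j then d else e)"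

lemma pattern_self [simp]: "pattern c d e \<kappa> \<kappa> = d"
  by (cases \<kappa>) auto

lemma pattern_sym: "pattern c d e \<kappa> \<kappa>' = pattern c d e \<kappa>' \<kappa>"
  by (cases \<kappa>; cases \<kappa>') auto

lemma pattern_in: "pattern c d e \<kappa> \<kappa>' \<in> {c, d, e}"
  by (cases \<kappa>; cases \<kappa>') auto

text \<open>The pairs that get the weight \<open>e\<close>; comparing weights would not do, since \<open>c = e\<close> occurs.\<close>

abbreviation hostile :: "kind \<Rightarrow> kind \<Rightarrow> bool" where
  "hostile \<equiv> pattern False False True"

fun size_of :: "'b \<Rightarrow> 'b \<Rightarrow> kind \<Rightarrow> 'b :: one" where
  "size_of m M (Rover i) = m"
| "size_of m M (Anchor i) = M"
| "size_of m M (Guide i) = 1"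

lemma finite_kind: "finite (G :: kind set)"
proof -
  have cyc: "i \<in> {C0, C1, C2}" for i by (cases i) auto
  have "\<kappa> \<in> Rover ` {C0, C1, C2} \<union> Anchor ` {C0, C1, C2} \<union> Guide ` {C0, C1, C2}" for \<kappa>
    by (cases \<kappa>) (use cyc in \<open>auto simp only: Un_iff intro!: imageI\<close>)
  then have "G \<subseteq> Rover ` {C0, C1, C2} \<union> Anchor ` {C0, C1, C2} \<union> Guide ` {C0, C1, C2}" by (rule subsetI)
  then show ?thesis by (rule finite_subset) simp
qed

text \<open>Expanding from an arbitrary index \<open>i\<close> lets the simplifier evaluate a group
  relative to \<open>i\<close>, without splitting into three cases.\<close>

lemma sum_kind:
  fixes f :: "kind \<Rightarrow> real"
  shows "(\<Sum>\<kappa>\<in>G. f \<kappa>) =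
    (if Rover i \<in> G then f (Rover i) else 0) + (if Rover (nxt i) \<in> G then f (Rover (nxt i)) else 0) +
    (if Rover (nxt (nxt i)) \<in> G then f (Rover (nxt (nxt i))) else 0) +
    (if Anchor i \<in> G then f (Anchor i) else 0) + (if Anchor (nxt i) \<in> G then f (Anchor (nxt i)) else 0) +
    (if Anchor (nxt (nxt i)) \<in> G then f (Anchor (nxt (nxt i))) else 0) +
    (if Guide i \<in> G then f (Guide i) else 0) + (if Guide (nxt i) \<in> G then f (Guide (nxt i)) else 0) +
    (if Guide (nxt (nxt i)) \<in> G then f (Guide (nxt (nxt i))) else 0)"
proof -
  let ?K = "{Rover i, Rover (nxt i), Rover (nxt (nxt i)), Anchor i, Anchor (nxt i), Anchor (nxt (nxt i)),
    Guide i, Guide (nxt i), Guide (nxt (nxt i))}"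
  have "\<kappa> \<in> ?K" for \<kappa>
    by (cases \<kappa>) (use cyc3_cases[of _ i] in auto)
  then have "(\<Sum>\<kappa>\<in>G. f \<kappa>) = (\<Sum>\<kappa>\<in>?K. if \<kappa> \<in> G then f \<kappa> else 0)"
    by (intro sum.mono_neutral_cong_left) auto
  then show ?thesis by simp
qed

text \<open>By \<open>mc\<close>, the company of a rover class, worth \<open>m * d\<close>,
  outweighs the guide's advantage \<open>d - c\<close>. By \<open>M\<close>, a liked anchor beats
  every group without one; by \<open>aM\<close>, a hostile anchor class spoils everything else. This
  settles all but each rover's choice between two anchors, and the cyclic preferences refute every
  choice. Only deviations that bring no deviator together with a hostile class are needed, so
  \<open>- a\<close> may stand in for the enemy weight.\<close>

lemma no_stable_cycle:
  fixes a c d m M :: real and g :: "kind \<Rightarrow> kind set"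
  assumes a: "0 < a" and d: "0 < d" and cd: "c < d" and m: "1 \<le> m"
    and mc: "0 < (m - 1) * d + c"
    and M: "m * m + 3 * m + 3 \<le> M" and aM: "(3 * m + 3) * d < a * M"
    and refl: "\<And>\<kappa>. \<kappa> \<in> g \<kappa>" and eqg: "\<And>\<kappa> \<kappa>'. \<kappa>' \<in> g \<kappa> \<Longrightarrow> g \<kappa>' = g \<kappa>"
    and dev: "\<And>S X. S \<noteq> {} \<Longrightarrow> X \<in> insert {} (range g) \<Longrightarrow>
      (\<And>\<kappa> \<kappa>'. \<kappa> \<in> S \<Longrightarrow> \<kappa>' \<in> X \<union> S \<Longrightarrow> \<not> hostile \<kappa> \<kappa>') \<Longrightarrow>
      \<exists>\<kappa>\<in>S. (\<Sum>\<kappa>'\<in>X \<union> S. size_of m M \<kappa>' * pattern c d (- a) \<kappa> \<kappa>')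
        \<le> (\<Sum>\<kappa>'\<in>g \<kappa>. size_of m M \<kappa>' * pattern c d (- a) \<kappa> \<kappa>')"
  shows False
proof -
  define val where "val \<kappa> G = (\<Sum>\<kappa>'\<in>G. size_of m M \<kappa>' * pattern c d (- a) \<kappa> \<kappa>')" for \<kappa> G
    note dev = dev[folded val_def]
  have M0: "0 < M" using M m by (smt (verit) mult_nonneg_nonneg)
  have md: "d \<le> m * d" using m d by simp
  \<comment> \<open>A guide may have to bear a rover class at the possibly negative total
    \<open>m * c\<close>; \<open>mc\<close> bounds this from below.\<close>
  have "0 < m * ((m - 1) * d + c)" using m mc by (intro mult_pos_pos) auto
  then have c_lower: "- (m * c) < m * m * d - m * d" by (simp add: algebra_simps)
  have "(m * m + 3 * m + 3) * d \<le> M * d" using M d by (intro mult_right_mono) auto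
  then have Md: "m * m * d + 3 * (m * d) + 3 * d \<le> M * d" by (simp add: algebra_simps)
  have "0 \<le> m * m * d" using m d by simp
  have aM': "3 * (m * d) + 3 * d < M * a" using aM by (simp add: algebra_simps)
  have am: "0 \<le> m * a" "m * c \<le> m * d" using a m cd by auto
  note nums = a d cd md Md aM' am \<open>0 \<le> m * m * d\<close>
  have mem_sym: "\<kappa>' \<in> g \<kappa> \<Longrightarrow> \<kappa> \<in> g \<kappa>'" for \<kappa> \<kappa>'
    using refl eqg by metis
  \<comment> \<open>The class could leave and form a group of its own.\<close>
  have own: "size_of m M \<kappa> * d \<le> val \<kappa> (g \<kappa>)" for \<kappa>
  proof -
    have "\<exists>\<kappa>'\<in>{\<kappa>}. val \<kappa>' ({} \<union> {\<kappa>}) \<le> val \<kappa>' (g \<kappa>')"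
      by (rule dev) auto
    then show ?thesis by (simp add: val_def)
  qed
  have remove: "val \<kappa> G = size_of m M \<kappa>' * pattern c d (- a) \<kappa> \<kappa>' + val \<kappa> (G - {\<kappa>'})" if "\<kappa>' \<in> G" for \<kappa> \<kappa>' G
    unfolding val_def using that finite_kind by (intro sum.remove) auto
  \<comment> \<open>Without a liked anchor nothing beats all three rover classes and all three
    guides at weight \<open>d\<close>.\<close>
  have crude: "val \<kappa> G \<le> 3 * (m * d) + 3 * d" 
    if hostile: "\<And>j. Anchor j \<in> G \<Longrightarrow> hostile \<kappa> (Anchor j)" for \<kappa> G
  proof -
    define cap where "cap = case_kind (\<lambda>_. m * d) (\<lambda>_. 0) (\<lambda>_. d)"
    have le: "pattern c d (- a) \<kappa> \<kappa>' \<le> d" for \<kappa>'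
      using pattern_in[of c d "- a" \<kappa> \<kappa>'] a d cd by auto
    have "size_of m M \<kappa>' * pattern c d (- a) \<kappa> \<kappa>' \<le> cap \<kappa>'" if \<kappa>': "\<kappa>' \<in> G" for \<kappa>'
    proof (cases \<kappa>')
      case (Anchor j)
      then have "hostile \<kappa> (Anchor j)" using hostile \<kappa>' by blast
      then have "pattern c d (- a) \<kappa> (Anchor j) = - a" by (cases \<kappa>) (auto split: if_splits)
      then show ?thesis using Anchor M0 a by (simp add: cap_def)
    qed (use le[of \<kappa>'] m d in \<open>auto simp: cap_def\<close>)
    then have "val \<kappa> G \<le> sum cap G" unfolding val_def by (rule sum_mono)
    also have "\<dots> \<le> sum cap UNIV"
      using m d by (intro sum_mono2 finite_kind) (auto simp: cap_def split: kind.split)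
    also have "\<dots> = 3 * (m * d) + 3 * d"
      unfolding sum_kind[of _ _ C0] by (simp add: cap_def)
    finally show ?thesis .
  qed
  have repelled: "val \<kappa> G < 0"
    if "\<And>j. Anchor j \<in> G \<Longrightarrow> hostile \<kappa> (Anchor j)" "Anchor j \<in> G" for \<kappa> j G
  proof -
    have "hostile \<kappa> (Anchor j)" using that by blast
    then have "pattern c d (- a) \<kappa> (Anchor j) = - a" by (cases \<kappa>) (auto split: if_splits)
    then have "val \<kappa> G = - (M * a) + val \<kappa> (G - {Anchor j})" using remove[OF that(2)] by simp
    also have "val \<kappa> (G - {Anchor j}) \<le> 3 * (m * d) + 3 * d" by (rule crude) (use that in auto)
    finally show ?thesis using aM' by simp
  qed
  have anchors: "Anchor j \<in> g (Anchor i) \<longleftrightarrow> j = i" for i j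
  proof
    assume j: "Anchor j \<in> g (Anchor i)"
    show "j = i"
    proof (rule ccontr)
      assume "j \<noteq> i"
      \<comment> \<open>The own class is set aside first, being an anchor that is not hostile. A
        negative remainder makes the group worse than being alone.\<close>
      then have "val (Anchor i) (g (Anchor i) - {Anchor i}) < 0"
        using j by (intro repelled[of _ _ j]) auto
      then show False using remove[OF refl, of "Anchor i" "Anchor i"] own[of "Anchor i"] by simp
    qed
  qed (use refl in auto)
  have not_hostile: "\<not> hostile \<kappa> (Anchor i)" if "\<kappa> \<in> g (Anchor i)" for \<kappa> i
  proof
    assume h: "hostile \<kappa> (Anchor i)"
    have "val \<kappa> (g \<kappa>) < 0"
      by (rule repelled[of _ _ i]) (use h that anchors eqg in auto)
    moreover have "0 \<le> size_of m M \<kappa> * d" using m M0 d by (cases \<kappa>) auto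
    ultimately show False using own[of \<kappa>] by simp
  qed
  have guides: "Guide j \<in> g (Anchor i) \<Longrightarrow> j = i" for i j
    using not_hostile[of "Guide j" i] by (auto split: if_splits)
  have rovers: "Rover j \<in> g (Anchor i) \<Longrightarrow> j = i \<or> j = nxt i" for i j
    using not_hostile[of "Rover j" i] by (auto split: if_splits)
  have away: "Guide (nxt i) \<notin> g (Anchor i)" "Guide (nxt (nxt i)) \<notin> g (Anchor i)"
    "Rover (nxt (nxt i)) \<notin> g (Anchor i)" for i
    using guides[of "nxt i" i] guides[of "nxt (nxt i)" i] rovers[of "nxt (nxt i)" i] by auto
  \<comment> \<open>A guide elsewhere has no anchor at all, so \<open>crude\<close> caps its value;
    its own anchor is worth more, even with a rover at weight \<open>c\<close> next to it.\<close>
  have guide_home: "Guide i \<in> g (Anchor i)" for i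
  proof (rule ccontr)
    assume not_home: "Guide i \<notin> g (Anchor i)"
    have "Anchor j \<notin> g (Guide i)" for j
      using not_home guides[of i j] mem_sym by blast
    then have "val (Guide i) (g (Guide i)) \<le> 3 * (m * d) + 3 * d"
      by (intro crude) auto
    moreover have "\<exists>\<kappa>\<in>{Guide i}. val \<kappa> (g (Anchor i) \<union> {Guide i}) \<le> val \<kappa> (g \<kappa>)"
    proof (rule dev)
      fix \<kappa> \<kappa>'
      assume "\<kappa> \<in> {Guide i}" "\<kappa>' \<in> g (Anchor i) \<union> {Guide i}"
      then show "\<not> hostile \<kappa> \<kappa>'"
        by (cases \<kappa>') (auto simp: anchors dest: guides rovers)
    qed auto
    moreover have "M * d + d - m * m * d \<le> val (Guide i) (g (Anchor i) \<union> {Guide i})"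
    proof -
      have "val (Guide i) (g (Anchor i) \<union> {Guide i}) = M * d + d +
          (if Rover i \<in> g (Anchor i) then m * d else 0) +
          (if Rover (nxt i) \<in> g (Anchor i) then m * c else 0)"
        unfolding val_def sum_kind[of _ _ i] by (simp add: anchors away)
      then show ?thesis using c_lower md d \<open>0 \<le> m * m * d\<close> by (smt (verit))
    qed
    ultimately show False using nums by auto
  qed
  have guide_iff: "Guide j \<in> g (Anchor i) \<longleftrightarrow> j = i" for i j
    using guides guide_home by blast
  \<comment> \<open>Stated for \<open>nxt i\<close>, whose predecessor is simply
    \<open>i\<close>.\<close>
  have rover_home: "Rover (nxt i) \<in> g (Anchor i) \<or> Rover (nxt i) \<in> g (Anchor (nxt i))" for i
  proof (rule ccontr)
    let ?R = "Rover (nxt i)"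
    assume not_home: "\<not> ?thesis"
    have "Anchor j \<notin> g ?R" for j
      using not_home rovers[of "nxt i" j] mem_sym by auto
    then have "val ?R (g ?R) \<le> 3 * (m * d) + 3 * d"
      by (intro crude) auto
    moreover have "\<exists>\<kappa>\<in>{?R}. val \<kappa> (g (Anchor (nxt i)) \<union> {?R}) \<le> val \<kappa> (g \<kappa>)"
    proof (rule dev)
      fix \<kappa> \<kappa>'
      assume "\<kappa> \<in> {?R}" "\<kappa>' \<in> g (Anchor (nxt i)) \<union> {?R}"
      then show "\<not> hostile \<kappa> \<kappa>'"
        by (cases \<kappa>') (auto simp: anchors dest: guides rovers)
    qed auto
    moreover have "M * d + d + m * d \<le> val ?R (g (Anchor (nxt i)) \<union> {?R})"
    proof -
      have "val ?R (g (Anchor (nxt i)) \<union> {?R}) = M * d + d + m * d +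
          (if Rover (nxt (nxt i)) \<in> g (Anchor (nxt i)) then m * d else 0)"
        unfolding val_def sum_kind[of _ _ "nxt i"]
        by (simp add: anchors guide_iff away[of "nxt i", simplified])
      then show ?thesis using md d by (smt (verit))
    qed
    ultimately show False using nums by auto
  qed
  \<comment> \<open>From here on the truth values of \<open>p\<close> determine the groups of all
    three anchors.\<close>
  define p where "p i \<longleftrightarrow> Rover i \<in> g (Anchor i)" for i
  have anchor_unique: "Rover j \<in> g (Anchor i) \<Longrightarrow> Rover j \<in> g (Anchor i') \<Longrightarrow> i = i'" for i i' j
    using eqg anchors by metis
  have rover_nxt: "Rover (nxt i) \<in> g (Anchor i) \<longleftrightarrow> \<not> p (nxt i)" for i
    using rover_home[of i] anchor_unique[of "nxt i" i "nxt i"] by (auto simp: p_def)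
  have rover_iff: "Rover j \<in> g (Anchor i) \<longleftrightarrow> j = i \<and> p i \<or> j = nxt i \<and> \<not> p (nxt i)" for i j
    using rovers[of j i] rover_nxt[of i] by (auto simp: p_def)
  note mem = anchors guide_iff rover_iff
  have at_home: "val (Rover i) (g (Rover i)) = M * d + d + m * d + (if p (nxt i) then 0 else m * d)"
    if "p i" for i
  proof -
    have "g (Rover i) = g (Anchor i)" using that eqg by (simp add: p_def)
    then show ?thesis using that unfolding val_def sum_kind[of _ _ i] by (simp add: mem)
  qed
  have at_prev: "val (Rover (nxt i)) (g (Rover (nxt i))) = M * d + c + m * d + (if p i then m * d else 0)"
    if "\<not> p (nxt i)" for i
  proof -
    have "g (Rover (nxt i)) = g (Anchor i)" using that eqg rover_nxt by blast
    then show ?thesis using that unfolding val_def sum_kind[of _ _ i] by (simp add: mem)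
  qed
  \<comment> \<open>A rover alone at its second anchor would go home for the guide.\<close>
  have move_home: "p i" if not: "\<not> p (nxt i)" for i
  proof (rule ccontr)
    let ?R = "Rover (nxt i)"
    assume "\<not> p i"
    have "\<exists>\<kappa>\<in>{?R}. val \<kappa> (g (Anchor (nxt i)) \<union> {?R}) \<le> val \<kappa> (g \<kappa>)"
    proof (rule dev)
      fix \<kappa> \<kappa>'
      assume "\<kappa> \<in> {?R}" "\<kappa>' \<in> g (Anchor (nxt i)) \<union> {?R}"
      then show "\<not> hostile \<kappa> \<kappa>'" by (cases \<kappa>') (auto simp: mem)
    qed auto
    moreover have "M * d + d + m * d \<le> val ?R (g (Anchor (nxt i)) \<union> {?R})"
    proof -
      have "val ?R (g (Anchor (nxt i)) \<union> {?R}) = M * d + d + m * d +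
          (if p (nxt (nxt i)) then 0 else m * d)"
        unfolding val_def sum_kind[of _ _ "nxt i"] by (simp add: mem)
      then show ?thesis using md d by (smt (verit))
    qed
    ultimately show False using at_prev[OF not] \<open>\<not> p i\<close> cd by simp
  qed
  \<comment> \<open>If rover \<open>nxt i\<close> is away, both others are at home. It then returns
    together with rover \<open>nxt (nxt i)\<close>: the former keeps company and gains
    \<open>d - c\<close>, the latter gives up \<open>d - c\<close> for company worth
    \<open>m * d\<close>.\<close>
  have all_home: "p (nxt i)" for i
  proof (rule ccontr)
    let ?S = "{Rover (nxt i), Rover (nxt (nxt i))}"
    assume not: "\<not> p (nxt i)"
    have p: "p i" "p (nxt (nxt i))"
      using move_home[of i] move_home[of "nxt i"] not by auto
    have "\<exists>\<kappa>\<in>?S. val \<kappa> (g (Anchor (nxt i)) \<union> ?S) \<le> val \<kappa> (g \<kappa>)"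
    proof (rule dev)
      fix \<kappa> \<kappa>'
      assume "\<kappa> \<in> ?S" "\<kappa>' \<in> g (Anchor (nxt i)) \<union> ?S"
      then show "\<not> hostile \<kappa> \<kappa>'" by (cases \<kappa>') (auto simp: mem)
    qed auto
    moreover have "val (Rover (nxt i)) (g (Anchor (nxt i)) \<union> ?S) = M * d + d + 2 * (m * d)"
      unfolding val_def sum_kind[of _ _ "nxt i"] by (simp add: mem)
    moreover have "val (Rover (nxt (nxt i))) (g (Anchor (nxt i)) \<union> ?S) = M * d + c + 2 * (m * d)"
      unfolding val_def sum_kind[of _ _ "nxt i"] by (simp add: mem)
    ultimately show False
      using at_prev[OF not] at_home[OF p(2)] p(1) cd mc by (auto simp: algebra_simps)
  qed
  have p: "p i" for i
    using all_home[of "nxt (nxt i)"] by simp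
  \<comment> \<open>With every rover alone at home, one of them prefers the company at its second
    anchor.\<close>
  let ?R = "Rover C1"
  have "\<exists>\<kappa>\<in>{?R}. val \<kappa> (g (Anchor C0) \<union> {?R}) \<le> val \<kappa> (g \<kappa>)"
  proof (rule dev)
    fix \<kappa> \<kappa>'
    assume "\<kappa> \<in> {?R}" "\<kappa>' \<in> g (Anchor C0) \<union> {?R}"
    then show "\<not> hostile \<kappa> \<kappa>'" by (cases \<kappa>') (auto simp: mem)
  qed auto
  moreover have "val ?R (g (Anchor C0) \<union> {?R}) = M * d + c + 2 * (m * d)"
    unfolding val_def sum_kind[of _ _ C0] by (simp add: mem p)
  ultimately show False using at_home[OF p, of C1] p mc by (simp add: algebra_simps)
qed

section \<open>Realisation of the nine classes by natural numbers\<close>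

definition cyc3_of :: "nat \<Rightarrow> cyc3" where
  "cyc3_of n = (if n = 0 then C0 else if n = 1 then C1 else C2)"

text \<open>The remainder modulo 3 gives the index and the quotient the type. Below
  \<open>3 * (m + M + 1)\<close> there are \<open>m\<close> quotients for rovers, \<open>M\<close>
  for anchors and the single one \<open>m + M\<close> for guides.\<close>

definition kind_of :: "nat \<Rightarrow> nat \<Rightarrow> nat \<Rightarrow> kind" where
  "kind_of m M v = (if v div 3 < m then Rover else if v div 3 < m + M then Anchor else Guide) (cyc3_of (v mod 3))"

lemma card_residue_class:
  fixes l h L r :: nat
  assumes "h \<le> L" "r < 3"
  shows "card {v \<in> {..<3 * L}. l \<le> v div 3 \<and> v div 3 < h \<and> v mod 3 = r} = h - l"
proof -
  have "{v \<in> {..<3 * L}. l \<le> v div 3 \<and> v div 3 < h \<and> v mod 3 = r} = (\<lambda>q. 3 * q + r) ` {l..<h}"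
  proof (intro equalityI subsetI)
    fix v
    assume "v \<in> {v \<in> {..<3 * L}. l \<le> v div 3 \<and> v div 3 < h \<and> v mod 3 = r}"
    then have "v = 3 * (v div 3) + r" "v div 3 \<in> {l..<h}" by auto
    then show "v \<in> (\<lambda>q. 3 * q + r) ` {l..<h}" by (rule image_eqI)
  qed (use assms in auto)
  moreover have "inj_on (\<lambda>q. 3 * q + r) {l..<h}" by (auto intro: inj_onI)
  ultimately show ?thesis by (simp add: card_image)
qed

lemma card_kind_of:
  "card {v \<in> {..<3 * (m + M + 1)}. kind_of m M v = \<kappa>} = size_of m M \<kappa>"
proof -
  define num where "num = case_cyc3 0 1 (2 :: nat)"
  have num: "num i < 3" for i by (cases i) (auto simp: num_def)
  have idx: "cyc3_of (v mod 3) = i \<longleftrightarrow> v mod 3 = num i" for v i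
  proof -
    have "v mod 3 < 3" by simp
    then show ?thesis by (cases i) (auto simp: num_def cyc3_of_def)
  qed
  show ?thesis
  proof (cases \<kappa>)
    case (Rover i)
    have "{v \<in> {..<3 * (m + M + 1)}. kind_of m M v = \<kappa>} =
        {v \<in> {..<3 * (m + M + 1)}. 0 \<le> v div 3 \<and> v div 3 < m \<and> v mod 3 = num i}"
      unfolding Rover kind_of_def using idx by auto
    then show ?thesis using card_residue_class[of m "m + M + 1" "num i" 0] num Rover by simp
  next
    case (Anchor i)
    have "{v \<in> {..<3 * (m + M + 1)}. kind_of m M v = \<kappa>} =
        {v \<in> {..<3 * (m + M + 1)}. m \<le> v div 3 \<and> v div 3 < m + M \<and> v mod 3 = num i}"
      unfolding Anchor kind_of_def using idx by auto
    then show ?thesis using card_residue_class[of "m + M" "m + M + 1" "num i" m] num Anchor by simp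
  next
    case (Guide i)
    have "v div 3 < m + M + 1" if "v < 3 * (m + M + 1)" for v
      using that by (simp add: less_mult_imp_div_less mult.commute)
    then have "{v \<in> {..<3 * (m + M + 1)}. kind_of m M v = \<kappa>} =
        {v \<in> {..<3 * (m + M + 1)}. m + M \<le> v div 3 \<and> v div 3 < m + M + 1 \<and> v mod 3 = num i}"
      unfolding Guide kind_of_def using idx by auto
    then show ?thesis using card_residue_class[of "m + M + 1" "m + M + 1" "num i" "m + M"] num Guide by simp
  qed
qed

text \<open>The value of \<open>ew\<close> is only bounded from above, which covers both a negative
  integer and the enemy weight. The number of players serves as \<open>k\<close>, so that coalitions
  of any size may deviate.\<close>

lemma not_always_stable_cycle:
  fixes N :: int and m M :: nat and a c d :: real
  assumes W: "cw \<in> W" "dw \<in> W" "ew \<in> W" and N: "0 < N"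
    and bound: "\<And>i. Fin i \<in> {cw, dw, ew} \<Longrightarrow> int (3 * (m + M + 1)) * \<bar>i\<bar> \<le> N"
    and cw: "weight_value N cw = ereal c" and dw: "weight_value N dw = ereal d"
    and ew: "weight_value N ew \<le> ereal (- a)"
    and a: "0 < a" and d: "0 < d" and cd: "c < d" and m: "1 \<le> m"
    and mc: "0 < (real m - 1) * d + c"
    and M: "m * m + 3 * m + 3 \<le> M" and aM: "(3 * real m + 3) * d < a * real M"
  shows "\<not> always_stable (3 * (m + M + 1)) W"
proof
  define V where "V = {..<3 * (m + M + 1)}"
  let ?t = "kind_of m M" and ?r = "pattern cw dw ew" and ?\<rho> = "pattern c d (- a)"
  let ?w = "\<lambda>u v. ?r (?t u) (?t v)"
  have cardV: "card V = 3 * (m + M + 1)" and fin: "finite V" by (auto simp: V_def)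
  have in_W: "?r \<kappa> \<kappa>' \<in> W" for \<kappa> \<kappa>'
    using pattern_in[of cw dw ew \<kappa> \<kappa>'] W by auto
  have game: "coloring_game W V ?w N"
    unfolding coloring_game_def cardV
  proof (intro conjI ballI allI impI)
    fix u v i
    assume "?w u v = Fin i"
    then have "Fin i \<in> {cw, dw, ew}" using pattern_in[of cw dw ew "?t u" "?t v"] by simp
    then show "int (3 * (m + M + 1)) * \<bar>i\<bar> \<le> N" by (rule bound)
  qed (use fin N in_W pattern_sym in auto)
  assume "always_stable (3 * (m + M + 1)) W"
  then obtain P where part: "partition_on V P" and stable: "k_stable (card V) V ?w N P"
    using game unfolding always_stable_def cardV by blast
  have size: "card {v \<in> V. ?t v = \<kappa>} = size_of m M \<kappa>" for \<kappa>
    unfolding V_def by (rule card_kind_of)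
  have size_real: "real (size_of m M \<kappa>) = size_of (real m) (real M) \<kappa>" for \<kappa>
    by (cases \<kappa>) auto
  have onto: "?t ` V = UNIV"
  proof -
    have "\<kappa> \<in> ?t ` V" for \<kappa>
    proof -
      have "0 < size_of m M \<kappa>" using m M by (cases \<kappa>) auto
      then have "{v \<in> V. ?t v = \<kappa>} \<noteq> {}" by (metis size card.empty less_irrefl)
      then show ?thesis by blast
    qed
    then show ?thesis by blast
  qed
  have \<rho>_le: "weight_value N (?r \<kappa> \<kappa>') \<le> ereal (?\<rho> \<kappa> \<kappa>')" for \<kappa> \<kappa>'
    by (cases \<kappa>; cases \<kappa>') (use cw dw ew in auto)
  have \<rho>_eq: "weight_value N (?r \<kappa> \<kappa>') = ereal (?\<rho> \<kappa> \<kappa>')" if "\<not> hostile \<kappa> \<kappa>'" for \<kappa> \<kappa>'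
    using that by (cases \<kappa>; cases \<kappa>') (use cw dw in \<open>auto split: if_splits\<close>)
  obtain g where g: "\<And>\<kappa>. \<kappa> \<in> g \<kappa>" "\<And>\<kappa> \<kappa>'. \<kappa>' \<in> g \<kappa> \<Longrightarrow> g \<kappa>' = g \<kappa>"
    and dev: "\<And>S X. S \<noteq> {} \<Longrightarrow> X \<in> insert {} (range g) \<Longrightarrow>
      \<exists>\<kappa>\<in>S. class_value V ?t ?r N \<kappa> (X \<union> S) \<le> class_value V ?t ?r N \<kappa> (g \<kappa>)"
  proof -
    have "\<exists>d>0. weight_value N (?r \<kappa> \<kappa>) = ereal d" for \<kappa>
      using d dw by auto
    then show ?thesis
      using stable_blowup[OF fin onto _ part stable] that by blast
  qed
  show False
  proof (rule no_stable_cycle[OF a d cd _ mc _ aM g])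
    show "1 \<le> real m" using m by simp
    show "real m * real m + 3 * real m + 3 \<le> real M" using of_nat_mono[OF M, where 'a = real] by simp
    fix S X
    assume SX: "S \<noteq> {}" "X \<in> insert {} (range g)"
      and friendly: "\<And>\<kappa> \<kappa>'. \<kappa> \<in> S \<Longrightarrow> \<kappa>' \<in> X \<union> S \<Longrightarrow> \<not> hostile \<kappa> \<kappa>'"
    obtain \<kappa> where \<kappa>: "\<kappa> \<in> S"
      "class_value V ?t ?r N \<kappa> (X \<union> S) \<le> class_value V ?t ?r N \<kappa> (g \<kappa>)"
      using dev[OF SX] by blast
    \<comment> \<open>The new group is evaluated exactly because the deviation is friendly; for the
      old one an upper bound is enough to carry the inequality over to the reals.\<close>
    have new: "class_value V ?t ?r N \<kappa> (X \<union> S) =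
        ereal (\<Sum>\<kappa>'\<in>X \<union> S. real (card {v \<in> V. ?t v = \<kappa>'}) * ?\<rho> \<kappa> \<kappa>')"
      by (rule class_value_le(2)[OF fin onto \<rho>_le]) (use \<rho>_eq friendly \<kappa>(1) in blast)
    have old: "class_value V ?t ?r N \<kappa> (g \<kappa>) \<le>
        ereal (\<Sum>\<kappa>'\<in>g \<kappa>. real (card {v \<in> V. ?t v = \<kappa>'}) * ?\<rho> \<kappa> \<kappa>')"
      by (rule class_value_le(1)[OF fin onto \<rho>_le])
    have "(\<Sum>\<kappa>'\<in>X \<union> S. size_of (real m) (real M) \<kappa>' * ?\<rho> \<kappa> \<kappa>') \<le>
        (\<Sum>\<kappa>'\<in>g \<kappa>. size_of (real m) (real M) \<kappa>' * ?\<rho> \<kappa> \<kappa>')"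
      using order_trans[OF \<kappa>(2)[unfolded new] old] unfolding size size_real ereal_less_eq(3) .
    with \<kappa>(1) show "\<exists>\<kappa>\<in>S. (\<Sum>\<kappa>'\<in>X \<union> S. size_of (real m) (real M) \<kappa>' * ?\<rho> \<kappa> \<kappa>') \<le>
        (\<Sum>\<kappa>'\<in>g \<kappa>. size_of (real m) (real M) \<kappa>' * ?\<rho> \<kappa> \<kappa>')" by blast
  qed
qed

section \<open>Weight sets that admit games without stable partitions\<close>

text \<open>For \<open>m = 2\<close> the condition on company reads \<open>0 < d + c\<close>. The
  enemy weight lies below every \<open>- a\<close>, so \<open>a = d\<close> may be taken; then
  \<open>M = 14\<close> satisfies \<open>13 \<le> M\<close> and \<open>9 * d < a * M\<close>. The
  number of players is \<open>3 * (2 + 14 + 1) = 51\<close>.\<close>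

lemma not_always_stable_Enemy:
  fixes N :: int and c d :: real
  assumes W: "cw \<in> W" "dw \<in> W" "Enemy \<in> W" and N: "0 < N"
    and bound: "\<And>i. Fin i \<in> {cw, dw} \<Longrightarrow> 51 * \<bar>i\<bar> \<le> N"
    and cw: "weight_value N cw = ereal c" and dw: "weight_value N dw = ereal d"
    and cd: "c < d" "- d < c"
  shows "\<not> always_stable 51 W"
proof -
  have "\<not> always_stable (3 * (2 + 14 + 1)) W"
    by (rule not_always_stable_cycle[where m = 2 and M = 14, OF W N _ cw dw, of d])
      (use bound cd in auto)
  then show ?thesis by simp
qed

text \<open>Here \<open>- a\<close> plays both \<open>c\<close> and \<open>e\<close>. The choice
  \<open>m = a + 2\<close> makes \<open>(m - 1) * b - a\<close> positive, the factor
  \<open>b\<close> in \<open>M\<close> lets the hostile anchors outweigh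
  \<open>(3 * m + 3) * b\<close> already when \<open>a = 1\<close>, and \<open>N\<close> is large
  enough for both weights.\<close>

lemma not_always_stable_pos_neg:
  assumes W: "Fin (- a) \<in> W" "Fin b \<in> W" and a: "0 < a" and b: "0 < b"
  shows "\<exists>k. \<not> always_stable k W"
proof -
  define m where "m = nat (a + 2)"
  define M where "M = (m * m + 3 * m + 4) * nat b"
  define N where "N = int (3 * (m + M + 1)) * (a + b)"
  have m: "real m = real_of_int a + 2" using a by (simp add: m_def)
  have M: "real M = (real m * real m + 3 * real m + 4) * real_of_int b"
    using b by (simp add: M_def algebra_simps)
  have a1: "1 \<le> real_of_int a" and b1: "1 \<le> real_of_int b" using a b by auto
  have "\<not> always_stable (3 * (m + M + 1)) W"
  proof (rule not_always_stable_cycle[OF W(1) W(2) W(1)])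
    show "0 < N" using a b by (simp add: N_def)
    show "int (3 * (m + M + 1)) * \<bar>i\<bar> \<le> N" if "Fin i \<in> {Fin (- a), Fin b, Fin (- a)}" for i
      unfolding N_def by (rule mult_left_mono) (use that a b in auto)
    show "weight_value N (Fin (- a)) = ereal (- real_of_int a)" "weight_value N (Fin b) = ereal (real_of_int b)"
      "weight_value N (Fin (- a)) \<le> ereal (- real_of_int a)" by auto
    show "0 < real_of_int a" "0 < real_of_int b" "- real_of_int a < real_of_int b" "1 \<le> m"
      using a b by (auto simp: m_def)
    have "(real_of_int a + 1) * 1 \<le> (real_of_int a + 1) * real_of_int b"
      using a1 b1 by (intro mult_left_mono) auto
    then show "0 < (real m - 1) * real_of_int b + - real_of_int a" unfolding m by (simp add: algebra_simps)
    have "(m * m + 3 * m + 4) * 1 \<le> M" unfolding M_def by (rule mult_left_mono) (use b in auto)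
    then show "m * m + 3 * m + 3 \<le> M" by simp
    have "(3 * real m + 3) * real_of_int b < (real m * real m + 3 * real m + 4) * real_of_int b"
      using b1 by (intro mult_strict_right_mono) (auto intro: add_pos_nonneg)
    also have "\<dots> \<le> real_of_int a * real M"
      unfolding M[symmetric] using mult_right_mono[OF a1, of "real M"] by simp
    finally show "(3 * real m + 3) * real_of_int b < real_of_int a * real M" .
  qed
  then show ?thesis by blast
qed

section \<open>Case distinction on the weight set\<close>

theorem theorem14:
  fixes W :: "weight set"
  shows "stability_number W = \<infinity> \<longleftrightarrow>
    W = nonneg_part W \<or>
    W = nonpos_part W \<or>
    (\<exists>b. pos_int_weight b \<and> W = {Enemy, b}) \<or>
    (W = nonpos_part W \<union> {Best} \<and> Enemy \<notin> W)"
proof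
  assume "W = nonneg_part W \<or> W = nonpos_part W \<or>
    (\<exists>b. pos_int_weight b \<and> W = {Enemy, b}) \<or> (W = nonpos_part W \<union> {Best} \<and> Enemy \<notin> W)"
  then consider "\<And>x. x \<in> W \<Longrightarrow> nonneg_weight x" | "\<And>x. x \<in> W \<Longrightarrow> nonpos_weight x"
    | b where "pos_int_weight b" "W = {Enemy, b}"
    | "W = nonpos_part W \<union> {Best}" "Enemy \<notin> W"
    unfolding nonneg_part_def nonpos_part_def by blast
  then have "always_stable k W" for k
  proof cases
    case 4
    have "x = Best \<or> (\<exists>i\<le>0. x = Fin i)" if "x \<in> W" for x
    proof -
      have "x = Best \<or> nonpos_weight x" "x \<noteq> Enemy"
        using that 4 by (auto simp: nonpos_part_def)
      then show ?thesis by (cases x) auto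
    qed
    then show ?thesis by (rule always_stable_nonpos_Best)
  qed (auto intro: always_stable_nonneg always_stable_nonpos always_stable_Enemy_positive)
  then show "stability_number W = \<infinity>" by (simp add: stability_number_eq_infinity_iff)
next
  assume "stability_number W = \<infinity>"
  then have all: "always_stable k W" for k by (simp add: stability_number_eq_infinity_iff)
  show "W = nonneg_part W \<or> W = nonpos_part W \<or>
    (\<exists>b. pos_int_weight b \<and> W = {Enemy, b}) \<or> (W = nonpos_part W \<union> {Best} \<and> Enemy \<notin> W)"
  proof (rule ccontr)
    assume contra: "\<not> ?thesis"
    obtain x where x: "x \<in> W" "\<not> nonneg_weight x"
      using contra by (auto simp: nonneg_part_def)
    obtain y where y: "y \<in> W" "\<not> nonpos_weight y"
      using contra by (auto simp: nonpos_part_def)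
    have pos_neg: False if "Fin i \<in> W" "i < 0" "Fin j \<in> W" "0 < j" for i j
      using not_always_stable_pos_neg[of "- i" W j] that all by auto
    \<comment> \<open>The value of \<open>Best\<close> may be chosen:
      \<open>51 * \<bar>i\<bar> + 1\<close> respects the bound for 51 players and exceeds
      \<open>\<bar>i\<bar>\<close>, so that \<open>- d < c < d\<close>.\<close>
    have Best: False if "Fin i \<in> W" "Best \<in> W" "Enemy \<in> W" for i
    proof -
      have "\<not> always_stable 51 W"
        by (rule not_always_stable_Enemy[of "Fin i" W Best "51 * \<bar>i\<bar> + 1" "real_of_int i"
              "real_of_int (51 * \<bar>i\<bar> + 1)"]) (use that in auto)
      then show False using all by blast
    qed
    have positive: False if "Fin i \<in> W" "Fin j \<in> W" "Enemy \<in> W" "0 \<le> i" "i < j" for i j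
    proof -
      have "\<not> always_stable 51 W"
        by (rule not_always_stable_Enemy[of "Fin i" W "Fin j" "51 * j" "real_of_int i" "real_of_int j"])
          (use that in auto)
      then show False using all by blast
    qed
    \<comment> \<open>Otherwise \<open>x\<close> is a negative integer, which excludes positive
      integers, and \<open>W\<close> falls under the last case of the claim.\<close>
    have Enemy: "Enemy \<in> W"
    proof (rule ccontr)
      assume no: "Enemy \<notin> W"
      then obtain i where i: "Fin i \<in> W" "i < 0"
        using x by (cases x) auto
      have "y = Best" using y pos_neg[OF i] by (cases y) (auto simp: not_le)
      moreover have "z = Best \<or> nonpos_weight z" if "z \<in> W" for z
        using that pos_neg[OF i] by (cases z) (auto simp: not_le intro: leI)
      ultimately have "W = nonpos_part W \<union> {Best}" using y by (auto simp: nonpos_part_def)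
      with no contra show False by blast
    qed
    have "pos_int_weight y" using y by (cases y) auto
    then have "W \<noteq> {Enemy, y}" using contra by blast
    \<comment> \<open>A third weight besides \<open>Enemy\<close> and the positive \<open>y\<close>:
      each possible pair of \<open>y\<close> and \<open>z\<close> falls under
      \<open>pos_neg\<close>, \<open>Best\<close> or \<open>positive\<close>.\<close>
    then obtain z where z: "z \<in> W" "z \<noteq> Enemy" "z \<noteq> y" using Enemy y by blast
    show False
    proof (cases y)
      case (Fin j)
      then have "0 < j" using y by simp
      show ?thesis
      proof (cases z)
        case z_Fin: (Fin i)
        have "\<not> i < 0" using pos_neg[of i j] z z_Fin y Fin \<open>0 < j\<close> by auto
        then show ?thesis
          using positive[of i j] positive[of j i] z z_Fin y Fin Enemy \<open>0 < j\<close> by fastforce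
      qed (use z Best y Fin Enemy in auto)
    next
      case Best': Best
      then show ?thesis using z Best y Enemy by (cases z) auto
    qed (use y in auto)
  qed
qed

end
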